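(* Let $1\le p\le\infty$, $n\in\mathbb N=\{0,1,2,\dots\}$, and let $\psi\in\mathscr M_{n,p}$. Then the multiplication operator $T_\psi$ on $H_n^p(\mathbb C^+)$ is compact if and only if $\psi\equiv0$.
   Context: $\mathbb C^+=\{z\in\mathbb C:\operatorname{Im} z>0\}$. For $1\le p<\infty$, $H^p(\mathbb C^+)$ is the space of holomorphic $F$ on $\mathbb C^+$ with $\|F\|_{H^p}=\sup_{y>0}\left(\int_{\mathbb R}|F(x+iy)|^p\,dx\right)^{1/p}<\infty$; $H^\infty(\mathbb C^+)$ is the space of bounded holomorphic functions with the sup norm. $H_n^p(\mathbb C^+)$ is the Banach space of holomorphic $F$ on $\mathbb C^+$ with $F^{(k)}\in H^p(\mathbb C^+)$ for $k=0,1,\dots,n$, with norm $\|F\|_{H_n^p}=\left(\sum_{k=0}^n\|F^{(k)}\|_{H^p}^p\right)^{1/p}$ if $1\le p<\infty$ and $\|F\|_{H_n^\infty}=\sum_{k=0}^n\|F^{(k)}\|_{H^\infty}$ if $p=\infty$. $\mathscr M_{n,p}$ is the multiplier space: the set of holomorphic $\psi$ on $\mathbb C^+$ with $\psi F\in H_n^p(\mathbb C^+)$ for all $F\in H_n^p(\mathbb C^+)$. For $\psi\in\mathscr M_{n,p}$, $T_\psi:H_n^p(\mathbb C^+)\to H_n^p(\mathbb C^+)$ is $T_\psi F=\psi F$ (a bounded operator). *)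

theory Defs
  imports "HOL-Complex_Analysis.Complex_Analysis"
begin

text \<open>
  The exponent \<open>1 \<le> p \<le> \<infinity>\<close> is an extended nonnegative real. Functions on the upper half-plane are
  represented by total functions on the complex numbers whose values off the half-plane are
  irrelevant: every notion below (holomorphy, iterated derivatives, norms) depends only on the
  values on the open half-plane, and two functions are the same element of a space iff they agree
  there.
\<close>

definition UHP :: "complex set" where
  "UHP = {z. Im z > 0}"

text \<open>Power of an extended nonnegative real, used only with exponents \<open>a > 0\<close>.\<close>

definition epowr :: "ennreal \<Rightarrow> real \<Rightarrow> ennreal" where
  "epowr x a = (if x = \<infinity> then \<infinity> else ennreal (enn2real x powr a))"

definition Hardy_enorm :: "ennreal \<Rightarrow> (complex \<Rightarrow> complex) \<Rightarrow> ennreal" where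
  "Hardy_enorm p F =
     (if p = \<infinity> then (SUP z\<in>UHP. ennreal (norm (F z)))
      else (SUP y\<in>{0<..}.
              epowr (\<integral>\<^sup>+ x. ennreal (norm (F (Complex x y)) powr enn2real p) \<partial>lborel)
                (1 / enn2real p)))"

definition Hardy :: "ennreal \<Rightarrow> (complex \<Rightarrow> complex) set" where
  "Hardy p = {F. F holomorphic_on UHP \<and> Hardy_enorm p F < \<infinity>}"

definition Hardy_norm :: "ennreal \<Rightarrow> (complex \<Rightarrow> complex) \<Rightarrow> real" where
  "Hardy_norm p F = enn2real (Hardy_enorm p F)"

definition Hardy_Sobolev :: "nat \<Rightarrow> ennreal \<Rightarrow> (complex \<Rightarrow> complex) set" where
  "Hardy_Sobolev n p =
     {F. F holomorphic_on UHP \<and> (\<forall>k\<le>n. (deriv ^^ k) F \<in> Hardy p)}"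

definition Hardy_Sobolev_norm :: "nat \<Rightarrow> ennreal \<Rightarrow> (complex \<Rightarrow> complex) \<Rightarrow> real" where
  "Hardy_Sobolev_norm n p F =
     (if p = \<infinity> then (\<Sum>k\<le>n. Hardy_norm p ((deriv ^^ k) F))
      else (\<Sum>k\<le>n. Hardy_norm p ((deriv ^^ k) F) powr enn2real p) powr (1 / enn2real p))"

definition multipliers :: "nat \<Rightarrow> ennreal \<Rightarrow> (complex \<Rightarrow> complex) set" where
  "multipliers n p =
     {\<psi>. \<psi> holomorphic_on UHP \<and>
          (\<forall>F\<in>Hardy_Sobolev n p. (\<lambda>z. \<psi> z * F z) \<in> Hardy_Sobolev n p)}"

definition mult_op :: "(complex \<Rightarrow> complex) \<Rightarrow> (complex \<Rightarrow> complex) \<Rightarrow> complex \<Rightarrow> complex" where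
  "mult_op \<psi> F = (\<lambda>z. \<psi> z * F z)"

text \<open>
  Compactness of a linear operator on a space \<open>X\<close> of complex functions normed by \<open>N\<close>: the image of
  every bounded sequence has a subsequence that converges in \<open>X\<close> with respect to \<open>N\<close>.
\<close>

definition compact_operator_on ::
  "('a \<Rightarrow> complex) set \<Rightarrow> (('a \<Rightarrow> complex) \<Rightarrow> real) \<Rightarrow>
   (('a \<Rightarrow> complex) \<Rightarrow> ('a \<Rightarrow> complex)) \<Rightarrow> bool" where
  "compact_operator_on X N T \<longleftrightarrow>
     (\<forall>F\<in>X. T F \<in> X) \<and>
     (\<forall>F\<in>X. \<forall>G\<in>X. \<forall>a b. T (\<lambda>z. a * F z + b * G z) = (\<lambda>z. a * T F z + b * T G z)) \<and>
     (\<forall>F :: nat \<Rightarrow> 'a \<Rightarrow> complex.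
        (\<forall>j. F j \<in> X) \<and> bounded (range (\<lambda>j. N (F j))) \<longrightarrow>
        (\<exists>r G. strict_mono r \<and> G \<in> X \<and> (\<lambda>j. N (\<lambda>z. T (F (r j)) z - G z)) \<longlonglongrightarrow> 0))"

end

theory Submission
  imports Defs
begin

text \<open>
  Only the direction from compactness to \<open>\<psi> = 0\<close> has content. The obstruction to compactness is fast
  oscillation along the boundary. Take a zero-free \<open>F\<close> in the space, here \<open>F(z) = 1 / (z + i)\<^sup>2\<close>, and
  the functions \<open>F\<^sub>\<omega>(z) = \<omega>\<^bsup>-n\<^esup> e\<^bsup>i\<omega>z\<^esup> F(z)\<close> for \<open>\<omega> = 1, 2, \<dots>\<close>. They are bounded in the
  Hardy--Sobolev norm (\<open>modulated_quadratic_kernel_enorm_le\<close>), because at most \<open>n\<close> factors \<open>\<omega>\<close> are produced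
  by differentiation. If \<open>\<psi>\<close> acts compactly, a subsequence of \<open>\<psi> F\<^sub>\<omega> = \<omega>\<^bsup>-n\<^esup> e\<^bsup>i\<omega>z\<^esup> G\<close>, where
  \<open>G = \<psi> F\<close>, converges in norm. The exponential decays at each point of the open half-plane, so the
  limit can only be \<open>0\<close> (\<open>zero_if_limit_of_modulations\<close>).

  On the other hand the \<open>n\<close>-th derivative of \<open>\<omega>\<^bsup>-n\<^esup> e\<^bsup>i\<omega>z\<^esup> G\<close> is \<open>e\<^bsup>i\<omega>z\<^esup> (i\<^sup>n G + O(1 / \<omega>))\<close>, the error
  being measured in the Hardy norm because \<open>G\<close> is in the Hardy--Sobolev space. On the line at height
  \<open>1 / \<omega>\<close> the exponential has the constant modulus \<open>1 / e\<close>. So the norm convergence to \<open>0\<close> forces \<open>G\<close> to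
  be small on these lines (\<open>horizontal_integral_le_modulation\<close>), which approach the real axis; then \<open>G\<close> has
  zero boundary values, \<open>G = 0\<close>, and \<open>\<psi> = 0\<close>.

  To reach the last conclusion without boundary values or Poisson integrals, and uniformly in the
  exponent, smallness is measured by the integrals of \<open>G\<close> over horizontal segments \<open>[z, z + h]\<close> with
  \<open>h \<le> 1\<close>. They are bounded by the Hardy norm (\<open>integral_segment_le_Hardy_norm\<close>), holomorphic in \<open>z\<close>, and
  uniformly small on the lines in question, so the Phragmen--Lindeloef principle
  (\<open>Phragmen_Lindelof_half_plane\<close>) shows that they vanish. Differentiating in \<open>h\<close> at \<open>0\<close> gives \<open>G = 0\<close>
  (\<open>zero_if_horizontal_integrals_vanish_at_boundary\<close>).
\<close>

section \<open>Hardy norms in terms of horizontal lines\<close>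

lemma open_UHP: "open UHP"
  unfolding UHP_def by (rule open_halfspace_Im_gt)

lemma convex_UHP: "convex UHP"
  unfolding UHP_def by (rule convex_halfspace_Im_gt)

lemma UHP_shift: "z \<in> UHP \<Longrightarrow> z + of_real t \<in> UHP"
  by (simp add: UHP_def)

text \<open>
  A bound on the \<open>1 / a\<close>-th power of an integral becomes a bound on the integral itself. This reduces
  estimates of the Hardy norm to estimates of integrals over individual horizontal lines.
\<close>
lemma epowr_le_iff:
  assumes "a > 0" "M \<ge> 0"
  shows "epowr X (1 / a) \<le> ennreal M \<longleftrightarrow> X \<le> ennreal (M powr a)"
proof (cases X)
  case (real x)
  have "x powr (1 / a) \<le> M \<longleftrightarrow> x \<le> M powr a"
  proof
    assume "x powr (1 / a) \<le> M"
    then have "(x powr (1 / a)) powr a \<le> M powr a"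
      using assms by (intro powr_mono2) auto
    then show "x \<le> M powr a"
      using assms real by (simp add: powr_powr)
  next
    assume "x \<le> M powr a"
    then have "x powr (1 / a) \<le> (M powr a) powr (1 / a)"
      using assms real by (intro powr_mono2) auto
    then show "x powr (1 / a) \<le> M"
      using assms by (simp add: powr_powr)
  qed
  then show ?thesis
    using real assms by (simp add: epowr_def)
next
  case top
  then show ?thesis
    by (simp add: epowr_def top_unique)
qed

lemma Hardy_enorm_infinity_le_iff:
  assumes "M \<ge> 0"
  shows "Hardy_enorm \<infinity> f \<le> ennreal M \<longleftrightarrow> (\<forall>z\<in>UHP. norm (f z) \<le> M)"
  using assms by (simp add: Hardy_enorm_def SUP_le_iff)

lemma enn2real_exponent_ge_1:
  assumes "1 \<le> p" "p \<noteq> \<infinity>"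
  shows "1 \<le> enn2real p"
  using assms by (cases p) (auto simp flip: ennreal_1)

lemma Hardy_enorm_le_iff:
  assumes "1 \<le> p" "p \<noteq> \<infinity>" "M \<ge> 0"
  shows "Hardy_enorm p f \<le> ennreal M \<longleftrightarrow>
    (\<forall>y>0. (\<integral>\<^sup>+ x. ennreal (norm (f (Complex x y)) powr enn2real p) \<partial>lborel)
       \<le> ennreal (M powr enn2real p))"
proof -
  have "enn2real p > 0"
    using enn2real_exponent_ge_1[OF assms(1,2)] by simp
  then show ?thesis
    using assms by (auto simp: Hardy_enorm_def SUP_le_iff epowr_le_iff)
qed

lemma Hardy_enorm_cong:
  assumes "\<And>z. z \<in> UHP \<Longrightarrow> f z = g z"
  shows "Hardy_enorm p f = Hardy_enorm p g"
proof -
  have "f (Complex x y) = g (Complex x y)" if "y > 0" for x y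
    using assms that by (simp add: UHP_def)
  then show ?thesis
    unfolding Hardy_enorm_def using assms by (auto intro!: SUP_cong)
qed

lemma Hardy_enorm_eq_norm:
  assumes "f \<in> Hardy p"
  shows "Hardy_enorm p f = ennreal (Hardy_norm p f)"
  using assms by (simp add: Hardy_def Hardy_norm_def)

lemma Hardy_norm_nonneg: "Hardy_norm p f \<ge> 0"
  by (simp add: Hardy_norm_def)

lemma Hardy_norm_le:
  assumes "Hardy_enorm p f \<le> ennreal M" "M \<ge> 0"
  shows "Hardy_norm p f \<le> M"
  using assms unfolding Hardy_norm_def
  by (metis enn2real_ennreal enn2real_mono ennreal_less_top)

lemma HardyI:
  assumes "f holomorphic_on UHP" "Hardy_enorm p f \<le> ennreal M"
  shows "f \<in> Hardy p"
  using assms by (auto simp: Hardy_def intro: le_less_trans)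

lemma slice_measurable:
  assumes "continuous_on UHP f" "y > 0"
  shows "(\<lambda>x. f (Complex x y)) \<in> borel_measurable borel"
proof (rule borel_measurable_continuous_onI)
  have "continuous_on UNIV (\<lambda>x. f (of_real x + of_real y * \<i>))"
    by (rule continuous_on_compose2[OF assms(1)])
       (use assms(2) in \<open>auto intro!: continuous_intros simp: UHP_def\<close>)
  then show "continuous_on UNIV (\<lambda>x. f (Complex x y))"
    by (simp add: Complex_eq mult.commute)
qed

text \<open>
  Finiteness of the norm of a difference has to be known before its real-valued norm carries any
  information, since the conversion from extended reals sends \<open>\<infinity>\<close> to \<open>0\<close>. For finite exponents it follows
  from the crude pointwise bound \<open>\<bar>a - b\<bar>\<^sup>q \<le> 2\<^sup>q (\<bar>a\<bar>\<^sup>q + \<bar>b\<bar>\<^sup>q)\<close>.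
\<close>
lemma Hardy_diff:
  assumes p: "1 \<le> p" and f: "f \<in> Hardy p" and g: "g \<in> Hardy p"
  shows "(\<lambda>z. f z - g z) \<in> Hardy p"
proof -
  define A where "A = Hardy_norm p f"
  define B where "B = Hardy_norm p g"
  have A: "A \<ge> 0" "Hardy_enorm p f \<le> ennreal A"
    using Hardy_enorm_eq_norm[OF f] by (simp_all add: A_def Hardy_norm_nonneg)
  have B: "B \<ge> 0" "Hardy_enorm p g \<le> ennreal B"
    using Hardy_enorm_eq_norm[OF g] by (simp_all add: B_def Hardy_norm_nonneg)
  have hol: "f holomorphic_on UHP" "g holomorphic_on UHP"
    using f g by (simp_all add: Hardy_def)
  have "\<exists>M. Hardy_enorm p (\<lambda>z. f z - g z) \<le> ennreal M"
  proof (cases "p = \<infinity>")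
    case True
    have "norm (f z - g z) \<le> A + B" if "z \<in> UHP" for z
    proof -
      have "norm (f z) \<le> A" "norm (g z) \<le> B"
        using A B that Hardy_enorm_infinity_le_iff unfolding True by blast+
      then show ?thesis
        using norm_triangle_ineq4[of "f z" "g z"] by linarith
    qed
    then have "Hardy_enorm \<infinity> (\<lambda>z. f z - g z) \<le> ennreal (A + B)"
      using A(1) B(1) by (subst Hardy_enorm_infinity_le_iff) auto
    then show ?thesis
      unfolding True by blast
  next
    case False
    define q where "q = enn2real p"
    have q: "q \<ge> 1"
      using enn2real_exponent_ge_1[OF p False] by (simp add: q_def)
    define C where "C = 2 powr q * (A powr q + B powr q)"
    have C: "C \<ge> 0" by (simp add: C_def)
    have elem: "norm (a - b) powr q \<le> 2 powr q * (norm a powr q + norm b powr q)" for a b :: complex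
    proof -
      define m where "m = max (norm a) (norm b)"
      have "norm (a - b) \<le> 2 * m"
        using norm_triangle_ineq4[of a b] by (auto simp: m_def)
      then have "norm (a - b) powr q \<le> (2 * m) powr q"
        using q by (intro powr_mono2) auto
      also have "\<dots> = 2 powr q * m powr q"
        by (rule powr_mult)
      also have "m powr q \<le> norm a powr q + norm b powr q"
        by (auto simp: m_def max_def)
      finally show ?thesis by simp
    qed
    have "(\<integral>\<^sup>+ x. ennreal (norm (f (Complex x y) - g (Complex x y)) powr q) \<partial>lborel)
        \<le> ennreal C" if "y > 0" for y
    proof -
      have [measurable]: "(\<lambda>x. f (Complex x y)) \<in> borel_measurable borel"
          "(\<lambda>x. g (Complex x y)) \<in> borel_measurable borel"
        using hol that by (auto intro!: slice_measurable holomorphic_on_imp_continuous_on)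
      have "(\<integral>\<^sup>+ x. ennreal (norm (f (Complex x y) - g (Complex x y)) powr q) \<partial>lborel)
        \<le> (\<integral>\<^sup>+ x. ennreal (2 powr q) * (ennreal (norm (f (Complex x y)) powr q)
              + ennreal (norm (g (Complex x y)) powr q)) \<partial>lborel)"
        using elem by (intro nn_integral_mono) (simp flip: ennreal_mult ennreal_plus)
      also have "\<dots> = ennreal (2 powr q) *
          ((\<integral>\<^sup>+ x. ennreal (norm (f (Complex x y)) powr q) \<partial>lborel)
          + (\<integral>\<^sup>+ x. ennreal (norm (g (Complex x y)) powr q) \<partial>lborel))"
        by (simp add: nn_integral_cmult nn_integral_add)
      also have "\<dots> \<le> ennreal (2 powr q) * (ennreal (A powr q) + ennreal (B powr q))"
        using A B that Hardy_enorm_le_iff[OF p False]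
        by (intro mult_left_mono add_mono) (auto simp: q_def)
      also have "\<dots> = ennreal C"
        by (simp add: C_def ennreal_mult flip: ennreal_plus)
      finally show ?thesis .
    qed
    then have "Hardy_enorm p (\<lambda>z. f z - g z) \<le> ennreal (C powr (1 / q))"
      using C q by (subst Hardy_enorm_le_iff[OF p False]) (auto simp: powr_powr simp flip: q_def)
    then show ?thesis by blast
  qed
  then show ?thesis
    using hol by (auto intro!: HardyI holomorphic_intros)
qed

lemma nn_integral_inverse_1_plus_square_le:
  "(\<integral>\<^sup>+ x. ennreal (1 / (1 + x\<^sup>2)) \<partial>lborel) \<le> ennreal pi"
proof -
  let ?g = "\<lambda>x::real. 1 / (1 + x\<^sup>2)"
  have half: "(\<integral>\<^sup>+ x. ennreal (?g x) * indicator {0..} x \<partial>lborel) = ennreal (pi / 2)"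
  proof -
    have "(\<integral>\<^sup>+ x. ennreal (?g x) * indicator {0..} x \<partial>lborel) = ennreal (pi / 2 - arctan 0)"
    proof (rule nn_integral_FTC_atLeast)
      show "DERIV arctan x :> ?g x" for x
        using DERIV_arctan[of x] by (simp add: inverse_eq_divide)
    qed (auto intro: tendsto_arctan_at_top)
    then show ?thesis by simp
  qed
  have "(\<integral>\<^sup>+ x. ennreal (?g x) \<partial>lborel) \<le>
    (\<integral>\<^sup>+ x. ennreal (?g x) * indicator {0..} x + ennreal (?g (0 + (-1) * x)) * indicator {0..} (0 + (-1) * x) \<partial>lborel)"
    by (intro nn_integral_mono) (auto simp: indicator_def)
  also have "\<dots> = (\<integral>\<^sup>+ x. ennreal (?g x) * indicator {0..} x \<partial>lborel)
      + (\<integral>\<^sup>+ x. ennreal (?g (0 + (-1) * x)) * indicator {0..} (0 + (-1) * x) \<partial>lborel)"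
    by (rule nn_integral_add) simp_all
  also have "(\<integral>\<^sup>+ x. ennreal (?g (0 + (-1) * x)) * indicator {0..} (0 + (-1) * x) \<partial>lborel)
      = (\<integral>\<^sup>+ x. ennreal (?g x) * indicator {0..} x \<partial>lborel)"
    by (subst nn_integral_real_affine[where c = "-1" and t = 0]) simp_all
  finally show ?thesis
    unfolding half by (simp flip: ennreal_plus)
qed

text \<open>
  One pointwise bound serves all exponents at once: \<open>1 / (1 + x\<^sup>2)\<close> is at most \<open>1\<close>, so its \<open>q\<close>-th power
  is at most itself, and its integral over the line is \<open>\<pi>\<close>. As \<open>\<pi> \<ge> 1\<close>, the factor \<open>\<pi> powr (1 / q)\<close> that comes
  out is at most \<open>\<pi>\<close>.
\<close>
lemma Hardy_enorm_le_of_decay: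
  assumes p: "1 \<le> p" and C: "C \<ge> 0"
    and le: "\<And>z. z \<in> UHP \<Longrightarrow> norm (f z) \<le> C / (1 + (Re z)\<^sup>2)"
  shows "Hardy_enorm p f \<le> ennreal (C * pi)"
proof (cases "p = \<infinity>")
  case True
  have "norm (f z) \<le> C * pi" if "z \<in> UHP" for z
  proof -
    have "norm (f z) \<le> C / (1 + (Re z)\<^sup>2)"
      using le that .
    also have "\<dots> \<le> C / 1"
      using C by (intro divide_left_mono) (auto simp: add_pos_nonneg)
    also have "\<dots> \<le> C * pi"
      using C pi_gt3 mult_left_mono[of 1 pi C] by simp
    finally show ?thesis .
  qed
  then show ?thesis
    unfolding True using C by (subst Hardy_enorm_infinity_le_iff) auto
next
  case False
  define q where "q = enn2real p"
  have q: "q \<ge> 1"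
    using enn2real_exponent_ge_1[OF p False] by (simp add: q_def)
  have "(\<integral>\<^sup>+ x. ennreal (norm (f (Complex x y)) powr q) \<partial>lborel) \<le> ennreal ((C * pi) powr q)"
    if "y > 0" for y
  proof -
    have pt: "norm (f (Complex x y)) powr q \<le> C powr q * (1 / (1 + x\<^sup>2))" for x
    proof -
      have "norm (f (Complex x y)) powr q \<le> (C * (1 / (1 + x\<^sup>2))) powr q"
        using le[of "Complex x y"] that q by (intro powr_mono2) (auto simp: UHP_def)
      also have "\<dots> = C powr q * (1 / (1 + x\<^sup>2)) powr q"
        by (rule powr_mult)
      also have "(1 / (1 + x\<^sup>2)) powr q \<le> (1 / (1 + x\<^sup>2)) powr 1"
        using q by (intro powr_mono') (auto simp: add_pos_nonneg)
      finally show ?thesis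
        by (simp add: mult_left_mono add_nonneg_nonneg)
    qed
    have "(\<integral>\<^sup>+ x. ennreal (norm (f (Complex x y)) powr q) \<partial>lborel)
        \<le> (\<integral>\<^sup>+ x. ennreal (C powr q) * ennreal (1 / (1 + x\<^sup>2)) \<partial>lborel)"
      using pt by (intro nn_integral_mono) (simp flip: ennreal_mult)
    also have "\<dots> = ennreal (C powr q) * (\<integral>\<^sup>+ x. ennreal (1 / (1 + x\<^sup>2)) \<partial>lborel)"
      by (rule nn_integral_cmult) simp
    also have "\<dots> \<le> ennreal (C powr q) * ennreal pi"
      by (intro mult_left_mono nn_integral_inverse_1_plus_square_le) simp
    also have "\<dots> = ennreal (C powr q * pi)"
      by (simp add: ennreal_mult)
    also have "\<dots> \<le> ennreal (C powr q * pi powr q)"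
      using q pi_gt3 powr_mono[of 1 q pi]
      by (intro ennreal_leI mult_left_mono) auto
    also have "\<dots> = ennreal ((C * pi) powr q)"
      using C by (simp add: powr_mult)
    finally show ?thesis .
  qed
  then show ?thesis
    using C by (subst Hardy_enorm_le_iff[OF p False]) (auto simp: q_def)
qed

section \<open>Integrals over horizontal segments\<close>

text \<open>
  A Hoelder inequality on a segment of length at most \<open>1\<close>, with the harmless constant \<open>2\<close> in place of
  \<open>1\<close>. It follows by integrating the elementary inequality \<open>a \<le> L + L\<^bsup>1-q\<^esup> a\<^sup>q\<close>, which is clear when \<open>a \<le> L\<close>
  and follows from \<open>(a / L)\<^bsup>q-1\<^esup> \<ge> 1\<close> otherwise. This is the sole passage from Hardy norms to pointwise
  information.
\<close>
lemma integral_segment_le_Hardy_norm: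
  assumes p: "1 \<le> p" and cont: "continuous_on UHP f"
    and M: "M \<ge> 0" "Hardy_enorm p f \<le> ennreal M"
    and z: "z \<in> UHP" and h: "0 \<le> h" "h \<le> 1"
  shows "integral {0..h} (\<lambda>t. norm (f (z + of_real t))) \<le> 2 * M"
proof -
  define g where "g = (\<lambda>t::real. norm (f (z + of_real t)))"
  have contg: "continuous_on UNIV g"
    unfolding g_def using z
    by (intro continuous_on_norm continuous_on_compose2[OF cont])
       (auto intro!: continuous_intros simp: UHP_shift)
  have int: "g integrable_on {0..h}"
    by (rule integrable_continuous_real) (rule continuous_on_subset[OF contg], simp)
  \<comment> \<open>The elementary inequality needs \<open>L > 0\<close>; the case \<open>M = 0\<close> is reached as a limit.\<close>
  have strict: "integral {0..h} g \<le> 2 * L" if L: "L > 0" "L \<ge> M" for L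
  proof (cases "p = \<infinity>")
    case True
    have "norm (f w) \<le> L" if "w \<in> UHP" for w
      using M L that Hardy_enorm_infinity_le_iff[OF M(1)] unfolding True by force
    then have "integral {0..h} g \<le> integral {0..h} (\<lambda>t. L)"
      using z int by (intro integral_le) (auto simp: g_def UHP_shift)
    also have "\<dots> \<le> 2 * L"
      using h L by (simp add: mult_right_mono)
    finally show ?thesis .
  next
    case False
    define q where "q = enn2real p"
    have q: "q \<ge> 1"
      using enn2real_exponent_ge_1[OF p False] by (simp add: q_def)
    have young: "a \<le> L + L powr (1 - q) * a powr q" if "a \<ge> 0" for a
    proof (cases "a \<le> L")
      case False
      then have a: "a > L" by simp
      have "a = a powr (1 - q) * a powr q"
        using a L by (simp flip: powr_add)
      also have "\<dots> \<le> L powr (1 - q) * a powr q"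
        using a L q by (intro mult_right_mono powr_mono2') auto
      finally show ?thesis using L by simp
    qed (simp add: add_increasing2)
    have y: "Im z > 0"
      using z by (simp add: UHP_def)
    have zt: "z + of_real t = Complex (Re z + 1 * t) (Im z)" for t
      by (simp add: complex_eq_iff)
    have [measurable]: "(\<lambda>x. f (Complex x (Im z))) \<in> borel_measurable borel"
      using cont y by (rule slice_measurable)
    have [measurable]: "g \<in> borel_measurable borel"
      using contg by (rule borel_measurable_continuous_onI)
    have shift: "(\<integral>\<^sup>+ t. ennreal (g t powr q) \<partial>lborel)
        = (\<integral>\<^sup>+ x. ennreal (norm (f (Complex x (Im z))) powr q) \<partial>lborel)"
      unfolding g_def zt
      by (subst (2) nn_integral_real_affine[where c = 1 and t = "Re z"]) simp_all
    have "(g has_integral integral {0..h} g) {0..h}"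
      using int by (rule integrable_integral)
    then have "ennreal (integral {0..h} g) = (\<integral>\<^sup>+ t. ennreal (indicator {0..h} t * g t) \<partial>lborel)"
      by (subst nn_integral_has_integral_lebesgue[of "{0..h}" g]) (auto simp: g_def)
    also have "\<dots> \<le> (\<integral>\<^sup>+ t. ennreal L * indicator {0..h} t
                     + ennreal (L powr (1 - q)) * ennreal (g t powr q) \<partial>lborel)"
    proof (intro nn_integral_mono)
      fix t
      show "ennreal (indicator {0..h} t * g t) \<le> ennreal L * indicator {0..h} t
              + ennreal (L powr (1 - q)) * ennreal (g t powr q)"
        using young[of "g t"] L
        by (cases "t \<in> {0..h}")
           (auto simp: g_def ennreal_leI simp flip: ennreal_mult ennreal_plus)
    qed
    also have "\<dots> = ennreal L * emeasure lborel {0..h}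
                 + ennreal (L powr (1 - q)) * (\<integral>\<^sup>+ t. ennreal (g t powr q) \<partial>lborel)"
      by (simp add: nn_integral_add nn_integral_cmult nn_integral_cmult_indicator)
    also have "\<dots> \<le> ennreal L * ennreal 1 + ennreal (L powr (1 - q)) * ennreal (L powr q)"
    proof (intro add_mono mult_left_mono)
      show "emeasure lborel {0..h} \<le> ennreal 1"
        using h by (simp add: ennreal_leI del: ennreal_1)
      have "(\<integral>\<^sup>+ x. ennreal (norm (f (Complex x (Im z))) powr q) \<partial>lborel) \<le> ennreal (M powr q)"
        using M y Hardy_enorm_le_iff[OF p False M(1)] by (auto simp: q_def)
      also have "\<dots> \<le> ennreal (L powr q)"
        using M L q by (intro ennreal_leI powr_mono2) auto
      finally show "(\<integral>\<^sup>+ t. ennreal (g t powr q) \<partial>lborel) \<le> ennreal (L powr q)"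
        unfolding shift .
    qed simp_all
    also have "\<dots> = ennreal (2 * L)"
      using L by (simp flip: ennreal_mult ennreal_plus powr_add)
    finally show ?thesis
      using L by simp
  qed
  have "integral {0..h} g \<le> 2 * M"
  proof (rule field_le_epsilon)
    fix e :: real
    assume "e > 0"
    then show "integral {0..h} g \<le> 2 * M + e"
      using strict[of "M + e / 2"] M by simp
  qed
  then show ?thesis
    by (simp add: g_def)
qed

section \<open>Bounded holomorphic functions on the half-plane\<close>

text \<open>
  The half-plane is unbounded, so the maximum principle is applied to \<open>P / (1 - i \<eta> z)\<close> on a large
  truncated half-plane: the denominator has modulus at least \<open>1\<close> there and grows linearly, which makes
  the quotient small on the far arc because \<open>P\<close> is bounded. Then \<open>\<eta>\<close> tends to \<open>0\<close>.
\<close>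
lemma Phragmen_Lindelof_half_plane:
  assumes hol: "P holomorphic_on UHP"
    and bdd: "\<And>z. z \<in> UHP \<Longrightarrow> norm (P z) \<le> B"
    and d: "0 < d" and line: "\<And>z. Im z = d \<Longrightarrow> norm (P z) \<le> e"
    and w: "d < Im w"
  shows "norm (P w) \<le> e"
proof -
  have B: "B \<ge> 0"
    using order_trans[OF norm_ge_zero bdd[of w]] w d by (simp add: UHP_def)
  have e: "e \<ge> 0"
    using line[of "Complex 0 d"] norm_ge_zero[of "P (Complex 0 d)"] by (simp del: norm_ge_zero)
  have damped: "norm (P w) \<le> e' * norm (1 - \<i> * of_real \<eta> * w)" if e': "e' > e" and \<eta>: "\<eta> > 0" for e' \<eta>
  proof -
    define D where "D = (\<lambda>z. 1 - \<i> * of_real \<eta> * z)"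
    have ReD: "Re (D z) \<ge> 1" if "Im z > 0" for z
      using that \<eta> by (simp add: D_def)
    have D1: "norm (D z) \<ge> 1" if "Im z > 0" for z
      using ReD[OF that] complex_Re_le_cmod[of "D z"] by linarith
    have D0: "D z \<noteq> 0" if "Im z > 0" for z
      using D1[OF that] by auto
    have Dbig: "norm (D z) \<ge> \<eta> * norm z - 1" for z
    proof -
      have "norm (\<i> * of_real \<eta> * z) \<le> norm (D z) + norm (1::complex)"
        using norm_triangle_ineq4[of 1 "D z"] by (simp add: D_def)
      then show ?thesis using \<eta> by (simp add: norm_mult)
    qed
    define Q where "Q = (\<lambda>z. P z / D z)"
    \<comment> \<open>Beyond radius \<open>(B / e' + 1) / \<eta>\<close> the bound \<open>B\<close> on \<open>P\<close> is absorbed by the denominator.\<close>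
    define R where "R = max (norm w + 1) ((B / e' + 1) / \<eta>)"
    define S where "S = {z. d < Im z} \<inter> ball 0 R"
    have S_UHP: "closure S \<subseteq> {z. d \<le> Im z} \<inter> cball 0 R"
    proof (rule closure_minimal)
      show "closed ({z. d \<le> Im z} \<inter> cball 0 R)"
        by (intro closed_Int closed_halfspace_Im_ge closed_cball)
    qed (auto simp: S_def)
    have openS: "open S"
      unfolding S_def by (intro open_Int open_halfspace_Im_gt open_ball)
    have holQ: "Q holomorphic_on UHP"
      unfolding Q_def using D0
      by (intro holomorphic_intros hol) (auto simp: UHP_def D_def intro!: holomorphic_intros)
    have clo_UHP: "closure S \<subseteq> UHP"
      using S_UHP d by (auto simp: UHP_def)
    have "norm (Q w) \<le> e'"
    proof (rule maximum_modulus_frontier[of Q S])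
      show "Q holomorphic_on interior S"
        using holQ clo_UHP closure_subset interior_subset by (blast intro: holomorphic_on_subset)
      show "continuous_on (closure S) Q"
        using holQ clo_UHP by (blast intro: holomorphic_on_imp_continuous_on continuous_on_subset)
      show "bounded S"
        unfolding S_def by (auto intro: bounded_subset[OF bounded_ball])
      show "w \<in> S"
        using w by (simp add: S_def R_def)
      show "norm (Q z) \<le> e'" if z: "z \<in> frontier S" for z
      proof -
        have zc: "d \<le> Im z" "norm z \<le> R"
          using z S_UHP by (auto simp: frontier_def)
        have "z \<notin> S"
          using z openS by (simp add: frontier_def interior_open)
        then consider "Im z = d" | "norm z = R"
          using zc by (auto simp: S_def)
        then show ?thesis
        proof cases
          case 1
          have "norm (P z) / norm (D z) \<le> e / 1"
            using line[OF 1] D1[of z] d 1 e by (intro frac_le) auto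
          then show ?thesis using e' by (simp add: Q_def norm_divide)
        next
          case 2
          have "(B / e' + 1) / \<eta> \<le> R" by (simp add: R_def)
          then have "B / e' \<le> \<eta> * norm z - 1"
            using \<eta> 2 by (simp add: field_simps)
          then have "B / e' \<le> norm (D z)"
            using Dbig[of z] by linarith
          moreover have "e' > 0" using e e' by simp
          ultimately have "B \<le> e' * norm (D z)"
            by (simp add: field_simps)
          moreover have "norm (P z) \<le> B"
            using bdd zc d by (simp add: UHP_def)
          ultimately have "norm (P z) \<le> e' * norm (D z)" by linarith
          then show ?thesis
            using D0[of z] zc d by (simp add: Q_def norm_divide field_simps)
        qed
      qed
    qed
    then show ?thesis
      using D0[of w] w d by (simp add: Q_def norm_divide field_simps D_def)
  qed
  show ?thesis
  proof (rule dense_ge)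
    fix e' assume e': "e < e'"
    have "((\<lambda>\<eta>. e' * norm (1 - \<i> * of_real \<eta> * w)) \<longlongrightarrow> e' * norm (1 - \<i> * of_real 0 * w)) (at_right 0)"
      by (intro tendsto_intros)
    then have "((\<lambda>\<eta>. e' * norm (1 - \<i> * of_real \<eta> * w)) \<longlongrightarrow> e') (at_right 0)"
      by simp
    moreover have "\<forall>\<^sub>F \<eta> in at_right 0. norm (P w) \<le> e' * norm (1 - \<i> * of_real \<eta> * w)"
      using damped[OF e'] by (auto simp: eventually_at_right_field intro: exI[of _ 1])
    ultimately show "norm (P w) \<le> e'"
      by (rule tendsto_lowerbound) simp
  qed
qed

section \<open>Segment integrals as holomorphic functions\<close>

lemma has_vector_derivative_along_horizontal:
  fixes z :: complex
  assumes "(A has_field_derivative D) (at (z + of_real t))"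
  shows "((\<lambda>u. A (z + of_real u)) has_vector_derivative D) (at t within S)"
proof -
  have "((\<lambda>w. z + w) has_field_derivative 1) (at (of_real t))"
    by (auto intro!: derivative_eq_intros)
  then have "((\<lambda>w. A (z + w)) has_field_derivative D * 1) (at (of_real t))"
    by (rule DERIV_chain2[where f = A and g = "\<lambda>w. z + w" and x = "of_real t", OF assms])
  then show ?thesis
    unfolding mult_1_right by (rule has_vector_derivative_real_field[where f = "\<lambda>w. A (z + w)"])
qed

text \<open>
  A primitive on the convex half-plane turns integrals over horizontal segments into differences,
  which depend holomorphically on the starting point.
\<close>
lemma horizontal_primitive:
  assumes "f holomorphic_on UHP"
  obtains A where "A holomorphic_on UHP"
    "\<And>z h. z \<in> UHP \<Longrightarrow> 0 \<le> h \<Longrightarrow>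
       ((\<lambda>t. f (z + of_real t)) has_integral (A (z + of_real h) - A z)) {0..h}"
    "\<And>z. z \<in> UHP \<Longrightarrow> (A has_field_derivative f z) (at z)"
proof -
  obtain A where A0: "\<And>z. z \<in> UHP \<Longrightarrow> (A has_field_derivative f z) (at z within UHP)"
    by (rule holomorphic_convex_primitive'[OF convex_UHP open_UHP assms]) blast
  have A: "(A has_field_derivative f z) (at z)" if "z \<in> UHP" for z
    using A0[OF that] unfolding at_within_open[OF that open_UHP] .
  have A_int: "((\<lambda>t. f (z + of_real t)) has_integral (A (z + of_real h) - A (z + of_real 0))) {0..h}"
    if "z \<in> UHP" "0 \<le> h" for z h
  proof (rule fundamental_theorem_of_calculus[where f = "\<lambda>u. A (z + of_real u)", OF that(2)])
    fix t
    show "((\<lambda>u. A (z + of_real u)) has_vector_derivative f (z + of_real t)) (at t within {0..h})"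
      by (rule has_vector_derivative_along_horizontal[where A = A, OF A[OF UHP_shift[OF that(1)]]])
  qed
  show ?thesis
  proof (rule that[OF _ _ A])
    show "A holomorphic_on UHP"
      unfolding holomorphic_on_def field_differentiable_def using A0 by blast
    show "((\<lambda>t. f (z + of_real t)) has_integral (A (z + of_real h) - A z)) {0..h}"
      if "z \<in> UHP" "0 \<le> h" for z h
      using A_int[OF that] by simp
  qed
qed

text \<open>
  The integral is over the segment from \<open>z\<close> to \<open>z + h\<close>. For a function in a Hardy space it is a bounded
  holomorphic function of \<open>z\<close>, and it is linear in \<open>f\<close>, so that working with these integrals for small
  \<open>h\<close> replaces both point evaluations and Minkowski's inequality.
\<close>
definition horizontal_integral :: "real \<Rightarrow> (complex \<Rightarrow> complex) \<Rightarrow> complex \<Rightarrow> complex" where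
  "horizontal_integral h f z = integral {0..h} (\<lambda>t. f (z + of_real t))"

lemma segment_integrable:
  fixes f :: "complex \<Rightarrow> 'a::banach"
  assumes "continuous_on UHP f" "z \<in> UHP"
  shows "(\<lambda>t. f (z + of_real t)) integrable_on {0..h}"
proof (rule integrable_continuous_real, rule continuous_on_compose2[OF assms(1)])
  show "continuous_on {0..h} (\<lambda>t. z + of_real t)"
    by (intro continuous_intros)
  show "(\<lambda>t. z + of_real t) ` {0..h} \<subseteq> UHP"
    by (intro image_subsetI UHP_shift assms(2))
qed

lemma norm_horizontal_integral_le:
  assumes "continuous_on UHP f" "z \<in> UHP"
  shows "norm (horizontal_integral h f z) \<le> integral {0..h} (\<lambda>t. norm (f (z + of_real t)))"
  unfolding horizontal_integral_def
proof (rule integral_norm_bound_integral[OF segment_integrable[OF assms]])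
  show "(\<lambda>t. norm (f (z + of_real t))) integrable_on {0..h}"
    by (rule segment_integrable[OF continuous_on_norm[OF assms(1)] assms(2)])
qed simp

lemma horizontal_integral_holomorphic:
  assumes "f holomorphic_on UHP" "0 \<le> h"
  shows "horizontal_integral h f holomorphic_on UHP"
proof (rule horizontal_primitive[OF assms(1)])
  fix A
  assume A: "A holomorphic_on UHP"
    "\<And>z h. z \<in> UHP \<Longrightarrow> 0 \<le> h \<Longrightarrow>
       ((\<lambda>t. f (z + of_real t)) has_integral (A (z + of_real h) - A z)) {0..h}"
  have "(\<lambda>z. z + of_real h) holomorphic_on UHP"
    by (intro holomorphic_intros)
  then have "(A \<circ> (\<lambda>z. z + of_real h)) holomorphic_on UHP"
    by (rule holomorphic_on_compose_gen[OF _ A(1)]) (rule image_subsetI, erule UHP_shift)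
  then have "(\<lambda>z. A (z + of_real h) - A z) holomorphic_on UHP"
    using A(1) unfolding o_def by (rule holomorphic_on_diff)
  moreover have "A (z + of_real h) - A z = horizontal_integral h f z" if "z \<in> UHP" for z
    unfolding horizontal_integral_def by (rule integral_unique[OF A(2)[OF that assms(2)], symmetric])
  ultimately show ?thesis
    by (rule holomorphic_transform)
qed

text \<open>
  The segment integral is the increment of a primitive \<open>A\<close>. If it is \<open>0\<close> for all small \<open>h\<close>, then \<open>A\<close> is
  constant to the right of \<open>z\<close>, so its one-sided derivative \<open>f z\<close> is \<open>0\<close>.
\<close>
lemma zero_if_horizontal_integrals_zero:
  assumes hol: "f holomorphic_on UHP"
    and zero: "\<And>h. 0 \<le> h \<Longrightarrow> h \<le> 1 \<Longrightarrow> horizontal_integral h f z = 0"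
    and z: "z \<in> UHP"
  shows "f z = 0"
proof -
  obtain A where A:
    "\<And>z h. z \<in> UHP \<Longrightarrow> 0 \<le> h \<Longrightarrow>
       ((\<lambda>t. f (z + of_real t)) has_integral (A (z + of_real h) - A z)) {0..h}"
    "\<And>z. z \<in> UHP \<Longrightarrow> (A has_field_derivative f z) (at z)"
    by (rule horizontal_primitive[OF hol]) blast
  have const: "A (z + of_real h) = A z" if "h \<in> {0..1}" for h
    using zero[of h] A(1)[OF z, of h] that by (auto simp: horizontal_integral_def integral_unique)
  have "((\<lambda>u. A (z + of_real u)) has_vector_derivative f z) (at 0 within {0..1})"
    by (rule has_vector_derivative_along_horizontal[where A = A]) (use A(2)[OF z] in simp)
  moreover have "((\<lambda>u. A (z + of_real u)) has_vector_derivative 0) (at 0 within {0..1})"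
    by (rule has_vector_derivative_transform[where f = "\<lambda>_. A z"]) (auto simp: const)
  ultimately show ?thesis
    using vector_derivative_unique_within[of 0 "{0..1::real}"]
    by (fastforce simp: at_within_Icc_at_right)
qed

text \<open>
  A uniqueness theorem for zero boundary values, with the boundary values read off on a sequence of
  lines at heights \<open>\<delta> j \<rightarrow> 0\<close>. For fixed \<open>h\<close> the segment integral is a bounded holomorphic function of
  its starting point, at most \<open>e j\<close> on the \<open>j\<close>-th line, hence at most \<open>e j\<close> above that line by the
  Phragmen--Lindeloef principle. A given point lies above all but finitely many of the lines.
\<close>
lemma zero_if_horizontal_integrals_vanish_at_boundary:
  assumes p: "1 \<le> p" and G: "G \<in> Hardy p"
    and \<delta>: "\<And>j. \<delta> j > 0" "\<delta> \<longlonglongrightarrow> 0" and e: "e \<longlonglongrightarrow> 0"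
    and small: "\<And>h j z. 0 \<le> h \<Longrightarrow> h \<le> 1 \<Longrightarrow> Im z = \<delta> j \<Longrightarrow> norm (horizontal_integral h G z) \<le> e j"
    and w: "w \<in> UHP"
  shows "G w = 0"
proof (rule zero_if_horizontal_integrals_zero[OF _ _ w])
  show hol: "G holomorphic_on UHP"
    using G by (simp add: Hardy_def)
  then have cont: "continuous_on UHP G"
    by (rule holomorphic_on_imp_continuous_on)
  fix h :: real assume h: "0 \<le> h" "h \<le> 1"
  have bdd: "norm (horizontal_integral h G z) \<le> 2 * Hardy_norm p G" if "z \<in> UHP" for z
    by (rule order_trans[OF norm_horizontal_integral_le[OF cont that]
          integral_segment_le_Hardy_norm[OF p cont Hardy_norm_nonneg _ that h]])
       (simp add: Hardy_enorm_eq_norm[OF G])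
  have "norm (horizontal_integral h G w) \<le> 0"
  proof (rule tendsto_lowerbound[OF e])
    have "\<forall>\<^sub>F j in sequentially. \<delta> j < Im w"
      using w by (intro order_tendstoD(2)[OF \<delta>(2)]) (simp add: UHP_def)
    then show "\<forall>\<^sub>F j in sequentially. norm (horizontal_integral h G w) \<le> e j"
    proof eventually_elim
      case (elim j)
      then show ?case
        using Phragmen_Lindelof_half_plane[OF horizontal_integral_holomorphic[OF hol h(1)] bdd \<delta>(1)] small[OF h]
        by blast
    qed
  qed simp
  then show "horizontal_integral h G w = 0" by simp
qed

section \<open>Modulation by a fast oscillation\<close>

lemma higher_deriv_exp_linear:
  "(deriv ^^ k) (\<lambda>w. exp (c * w)) z = c ^ k * exp (c * z)" for c z :: complex
proof (induction k arbitrary: z)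
  case (Suc k)
  have "(deriv ^^ k) (\<lambda>w. exp (c * w)) = (\<lambda>w. c ^ k * exp (c * w))"
    using Suc by blast
  then have "(deriv ^^ Suc k) (\<lambda>w. exp (c * w)) z = deriv (\<lambda>w. c ^ k * exp (c * w)) z"
    by simp
  also have "\<dots> = c ^ Suc k * exp (c * z)"
    by (rule DERIV_imp_deriv) (auto intro!: derivative_eq_intros)
  finally show ?case .
qed simp

text \<open>
  Multiplication by \<open>e\<^bsup>i\<omega>z\<^esup>\<close> has modulus close to \<open>1\<close> near the real axis but multiplies the \<open>n\<close>-th
  derivative by a factor of order \<open>\<omega>\<^sup>n\<close>; division by \<open>\<omega>\<^sup>n\<close> keeps the Sobolev norm bounded as \<open>\<omega>\<close> grows.
\<close>
definition modulate :: "nat \<Rightarrow> real \<Rightarrow> (complex \<Rightarrow> complex) \<Rightarrow> complex \<Rightarrow> complex" where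
  "modulate n \<omega> G z = exp (\<i> * of_real \<omega> * z) * (G z / of_real \<omega> ^ n)"

text \<open>
  The Leibniz expansion of the \<open>k\<close>-th derivative of the modulated function with the exponential
  divided out.
\<close>
definition modulation_symbol :: "nat \<Rightarrow> nat \<Rightarrow> real \<Rightarrow> (complex \<Rightarrow> complex) \<Rightarrow> complex \<Rightarrow> complex" where
  "modulation_symbol n k \<omega> G z =
     (\<Sum>i\<le>k. of_nat (k choose i) * (\<i> * of_real \<omega>) ^ i / of_real \<omega> ^ n * (deriv ^^ (k - i)) G z)"

lemma modulate_holomorphic:
  "G holomorphic_on UHP \<Longrightarrow> \<omega> > 0 \<Longrightarrow> modulate n \<omega> G holomorphic_on UHP"
  unfolding modulate_def[abs_def] by (intro holomorphic_intros) auto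

lemma higher_deriv_modulate:
  assumes G: "G holomorphic_on UHP" and z: "z \<in> UHP"
  shows "(deriv ^^ k) (modulate n \<omega> G) z = exp (\<i> * of_real \<omega> * z) * modulation_symbol n k \<omega> G z"
proof -
  define a where "a = inverse (of_real \<omega> ^ n :: complex)"
  have eq: "modulate n \<omega> G = (\<lambda>z. a * (exp ((\<i> * of_real \<omega>) * z) * G z))"
    by (auto simp: modulate_def a_def field_simps)
  have "(deriv ^^ k) (modulate n \<omega> G) z
      = a * (deriv ^^ k) (\<lambda>z. exp ((\<i> * of_real \<omega>) * z) * G z) z"
    unfolding eq by (rule higher_deriv_cmult[OF _ z open_UHP]) (intro holomorphic_intros G)
  also have "(deriv ^^ k) (\<lambda>z. exp ((\<i> * of_real \<omega>) * z) * G z) z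
      = (\<Sum>i = 0..k. of_nat (k choose i) * (deriv ^^ i) (\<lambda>z. exp ((\<i> * of_real \<omega>) * z)) z
            * (deriv ^^ (k - i)) G z)"
    by (rule higher_deriv_mult[OF _ G open_UHP z]) (intro holomorphic_intros)
  finally show ?thesis
    unfolding higher_deriv_exp_linear modulation_symbol_def sum_distrib_left a_def atLeast0AtMost
    by (simp add: divide_inverse mult_ac)
qed

lemma norm_exp_i_times: "norm (exp (\<i> * of_real \<omega> * z)) = exp (- (\<omega> * Im z))"
  by simp

text \<open>
  After division by \<open>\<omega>\<^sup>n\<close> only the term in which all \<open>n\<close> derivatives fall on the exponential survives
  as \<open>\<omega>\<close> grows.
\<close>
lemma modulation_coeff_norm:
  assumes "\<omega> \<ge> 1" "i \<le> n"
  shows "norm (of_nat m * (\<i> * of_real \<omega>) ^ i / of_real \<omega> ^ n :: complex) \<le> of_nat m"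
    and "i < n \<Longrightarrow> norm (of_nat m * (\<i> * of_real \<omega>) ^ i / of_real \<omega> ^ n :: complex) \<le> of_nat m / \<omega>"
proof -
  have eq: "norm (of_nat m * (\<i> * of_real \<omega>) ^ i / of_real \<omega> ^ n :: complex)
      = of_nat m * (\<omega> ^ i / \<omega> ^ n)"
    using assms by (simp add: norm_mult norm_divide norm_power)
  have "\<omega> ^ i / \<omega> ^ n \<le> 1"
    using assms by (simp add: divide_le_eq power_increasing)
  then show "norm (of_nat m * (\<i> * of_real \<omega>) ^ i / of_real \<omega> ^ n :: complex) \<le> of_nat m"
    unfolding eq by (rule mult_left_le) simp
  assume "i < n"
  then have "\<omega> ^ Suc i \<le> \<omega> ^ n"
    using assms by (intro power_increasing) auto
  then have "\<omega> ^ i / \<omega> ^ n \<le> 1 / \<omega>"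
    using assms by (simp add: field_simps)
  then have "of_nat m * (\<omega> ^ i / \<omega> ^ n) \<le> of_nat m * (1 / \<omega>)"
    by (intro mult_left_mono) auto
  then show "norm (of_nat m * (\<i> * of_real \<omega>) ^ i / of_real \<omega> ^ n :: complex) \<le> of_nat m / \<omega>"
    unfolding eq by simp
qed

text \<open>
  At height \<open>1 / \<omega>\<close> the exponential has modulus \<open>1 / e\<close>, so there the \<open>n\<close>-th derivative of the modulated
  function controls its Leibniz expansion up to the factor \<open>e\<close>. The leading term of the expansion is
  \<open>i\<^sup>n G\<close>, and the others are \<open>O(1 / \<omega>)\<close> because the derivatives of \<open>G\<close> lie in the Hardy space. In effect
  the Sobolev norm of a modulated function bounds the plain size of \<open>G\<close> near the boundary.
\<close>
lemma horizontal_integral_le_modulation: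
  assumes p: "1 \<le> p" and G: "G \<in> Hardy_Sobolev n p"
    and \<omega>: "\<omega> \<ge> 1"
    and N: "N \<ge> 0" "Hardy_enorm p ((deriv ^^ n) (modulate n \<omega> G)) \<le> ennreal N"
    and h: "0 \<le> h" "h \<le> 1" and z: "Im z = 1 / \<omega>"
  shows "norm (horizontal_integral h G z) \<le> 2 * exp 1 * N
    + (\<Sum>i<n. of_nat (n choose i) * (2 * Hardy_norm p ((deriv ^^ (n - i)) G))) / \<omega>"
proof -
  have holG: "G holomorphic_on UHP"
    using G by (simp add: Hardy_Sobolev_def)
  have Gk: "(deriv ^^ k) G \<in> Hardy p" if "k \<le> n" for k
    using G that by (simp add: Hardy_Sobolev_def)
  have cont_deriv: "continuous_on UHP ((deriv ^^ k) G)" for k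
    using holG open_UHP by (intro holomorphic_on_imp_continuous_on holomorphic_higher_deriv)
  have zU: "z \<in> UHP"
    using z \<omega> by (simp add: UHP_def)
  define E where "E = (deriv ^^ n) (modulate n \<omega> G)"
  define S where "S = modulation_symbol n n \<omega> G"
  define c where "c = (\<lambda>i. of_nat (n choose i) * (\<i> * of_real \<omega>) ^ i / of_real \<omega> ^ n :: complex)"
  define m where "m = (\<lambda>i. horizontal_integral h ((deriv ^^ (n - i)) G) z)"
  have S_eq: "S = (\<lambda>w. \<Sum>i\<le>n. c i * (deriv ^^ (n - i)) G w)"
    by (simp add: S_def modulation_symbol_def[abs_def] c_def)
  have contS: "continuous_on UHP S"
    unfolding S_eq by (intro continuous_intros cont_deriv)
  have contE: "continuous_on UHP E"
    unfolding E_def using modulate_holomorphic[OF holG] \<omega> open_UHP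
    by (intro holomorphic_on_imp_continuous_on holomorphic_higher_deriv) auto
  have SE: "norm (S (z + of_real t)) = exp 1 * norm (E (z + of_real t))" for t
  proof -
    have "\<omega> * Im (z + of_real t) = 1"
      using z \<omega> by simp
    then have "norm (E (z + of_real t)) = exp (- 1) * norm (S (z + of_real t))"
      unfolding E_def S_def higher_deriv_modulate[OF holG UHP_shift[OF zU]] norm_mult norm_exp_i_times
      by simp
    then show ?thesis
      by (simp add: exp_minus field_simps)
  qed
  have "norm (horizontal_integral h S z) \<le> integral {0..h} (\<lambda>t. norm (S (z + of_real t)))"
    by (rule norm_horizontal_integral_le[OF contS zU])
  also have "\<dots> = exp 1 * integral {0..h} (\<lambda>t. norm (E (z + of_real t)))"
    by (simp add: SE)
  also have "\<dots> \<le> exp 1 * (2 * N)"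
    using N by (intro mult_left_mono integral_segment_le_Hardy_norm[OF p contE _ _ zU h]) (auto simp: E_def)
  finally have 1: "norm (horizontal_integral h S z) \<le> 2 * exp 1 * N"
    by simp
  have "horizontal_integral h S z = (\<Sum>i\<le>n. c i * m i)"
    unfolding horizontal_integral_def S_eq m_def
    using segment_integrable[OF cont_deriv zU]
    by (subst integral_sum) (auto intro: integrable_on_mult_right)
  also have "\<dots> = c n * m n + (\<Sum>i<n. c i * m i)"
    by (simp add: lessThan_Suc_atMost[symmetric])
  \<comment> \<open>The coefficient \<open>c n = \<i>\<^sup>n\<close> belongs to the term in which no derivative falls on \<open>G\<close>.\<close>
  finally have "c n * m n = horizontal_integral h S z - (\<Sum>i<n. c i * m i)"
    by simp
  moreover have "norm (c n) = 1"
    using \<omega> by (simp add: c_def norm_divide norm_mult norm_power)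
  ultimately have "norm (m n) = norm (horizontal_integral h S z - (\<Sum>i<n. c i * m i))"
    by (metis mult_1 norm_mult)
  then have "norm (m n) \<le> norm (horizontal_integral h S z) + norm (\<Sum>i<n. c i * m i)"
    using norm_triangle_ineq4 by simp
  also have "norm (\<Sum>i<n. c i * m i)
      \<le> (\<Sum>i<n. of_nat (n choose i) / \<omega> * (2 * Hardy_norm p ((deriv ^^ (n - i)) G)))"
  proof (rule sum_norm_le)
    fix i assume i: "i \<in> {..<n}"
    have "norm (m i) \<le> integral {0..h} (\<lambda>t. norm ((deriv ^^ (n - i)) G (z + of_real t)))"
      unfolding m_def by (rule norm_horizontal_integral_le[OF cont_deriv zU])
    also have "\<dots> \<le> 2 * Hardy_norm p ((deriv ^^ (n - i)) G)"
      using Hardy_enorm_eq_norm[OF Gk[of "n - i"]]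
      by (intro integral_segment_le_Hardy_norm[OF p cont_deriv Hardy_norm_nonneg _ zU h]) simp
    finally show "norm (c i * m i) \<le> of_nat (n choose i) / \<omega> * (2 * Hardy_norm p ((deriv ^^ (n - i)) G))"
      unfolding norm_mult using i \<omega> modulation_coeff_norm(2)[OF \<omega>, of i n]
      by (intro mult_mono) (auto simp: c_def)
  qed
  also have "\<dots> = (\<Sum>i<n. of_nat (n choose i) * (2 * Hardy_norm p ((deriv ^^ (n - i)) G))) / \<omega>"
    by (simp add: sum_divide_distrib)
  finally show ?thesis
    using 1 by (simp add: m_def)
qed

section \<open>A bounded family of test functions\<close>

text \<open>
  A zero-free function all of whose derivatives decay at least like \<open>1 / (1 + x\<^sup>2)\<close>, so that it belongs
  to the Hardy--Sobolev spaces for all exponents simultaneously.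
\<close>
definition quadratic_kernel :: "complex \<Rightarrow> complex" where
  "quadratic_kernel z = 1 / (z + \<i>)\<^sup>2"

lemma UHP_shift_i_nonzero: "z \<in> UHP \<Longrightarrow> z + \<i> \<noteq> 0"
  by (auto simp: UHP_def complex_eq_iff)

lemma quadratic_kernel_holomorphic: "quadratic_kernel holomorphic_on UHP"
  unfolding quadratic_kernel_def[abs_def]
  by (intro holomorphic_intros) (auto dest: UHP_shift_i_nonzero)

lemma higher_deriv_quadratic_kernel:
  assumes "z \<in> UHP"
  shows "(deriv ^^ k) quadratic_kernel z = (-1) ^ k * fact (k + 1) / (z + \<i>) ^ (k + 2)"
  using assms
proof (induction k arbitrary: z)
  case 0
  then show ?case by (simp add: quadratic_kernel_def power2_eq_square)
next
  case (Suc k)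
  have "((\<lambda>w. inverse (w + \<i>)) has_field_derivative - (inverse (z + \<i>))\<^sup>2) (at z)"
    using UHP_shift_i_nonzero[OF Suc.prems] by (auto intro!: derivative_eq_intros simp: power2_eq_square)
  from DERIV_power_Suc[OF this, of "k + 1"]
  have "((\<lambda>w. inverse (w + \<i>) ^ (k + 2)) has_field_derivative
      (1 + of_nat (k + 1)) * (- (inverse (z + \<i>))\<^sup>2 * inverse (z + \<i>) ^ (k + 1))) (at z)"
    by (simp only: add_Suc_right numeral_2_eq_2 One_nat_def)
  then have pow: "((\<lambda>w. inverse (w + \<i>) ^ (k + 2)) has_field_derivative
      - of_nat (k + 2) * inverse (z + \<i>) ^ (Suc k + 2)) (at z)"
    by (rule DERIV_cong) (simp add: power2_eq_square algebra_simps)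
  have "deriv ((deriv ^^ k) quadratic_kernel) z = (-1) ^ Suc k * fact (Suc k + 1) / (z + \<i>) ^ (Suc k + 2)"
  proof (rule DERIV_imp_deriv, rule has_field_derivative_transform_within_open[OF _ open_UHP])
    show "((\<lambda>w. (-1) ^ k * fact (k + 1) / (w + \<i>) ^ (k + 2)) has_field_derivative
        (-1) ^ Suc k * fact (Suc k + 1) / (z + \<i>) ^ (Suc k + 2)) (at z)"
      unfolding divide_inverse power_inverse[symmetric] using DERIV_cmult[OF pow, of "(-1) ^ k * fact (k + 1)"]
      by (simp add: algebra_simps)
  qed (use Suc in simp_all)
  then show ?case by simp
qed

lemma quadratic_kernel_deriv_norm_le:
  assumes "z \<in> UHP"
  shows "norm ((deriv ^^ k) quadratic_kernel z) \<le> fact (k + 1) / (1 + (Re z)\<^sup>2)"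
proof -
  have y: "Im z > 0"
    using assms by (simp add: UHP_def)
  have n2: "norm (z + \<i>) ^ 2 = (Re z)\<^sup>2 + (Im z + 1)\<^sup>2"
    by (simp add: cmod_power2)
  have y1: "1 \<le> (Im z + 1)\<^sup>2"
    using y by (simp add: one_le_power)
  have n1: "norm (z + \<i>) \<ge> 1"
    using n2 y1 by (smt (verit) norm_ge_zero power2_le_imp_le one_power2 zero_le_power2)
  have "1 + (Re z)\<^sup>2 \<le> norm (z + \<i>) ^ 2"
    using n2 y1 by linarith
  also have "\<dots> \<le> norm (z + \<i>) ^ (k + 2)"
    using n1 by (intro power_increasing) auto
  finally have le: "1 + (Re z)\<^sup>2 \<le> norm (z + \<i>) ^ (k + 2)" .
  have "norm ((deriv ^^ k) quadratic_kernel z) = fact (k + 1) / norm (z + \<i>) ^ (k + 2)"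
    unfolding higher_deriv_quadratic_kernel[OF assms]
    by (simp add: norm_divide norm_mult norm_power del: fact_Suc power_Suc)
  also have "\<dots> \<le> fact (k + 1) / (1 + (Re z)\<^sup>2)"
    using le by (intro frac_le) (auto simp: add_pos_nonneg)
  finally show ?thesis .
qed

lemma quadratic_kernel_Hardy_Sobolev:
  assumes "1 \<le> p"
  shows "quadratic_kernel \<in> Hardy_Sobolev n p"
proof -
  have "(deriv ^^ k) quadratic_kernel \<in> Hardy p" for k
  proof (rule HardyI)
    show "(deriv ^^ k) quadratic_kernel holomorphic_on UHP"
      using quadratic_kernel_holomorphic open_UHP by (rule holomorphic_higher_deriv)
    show "Hardy_enorm p ((deriv ^^ k) quadratic_kernel) \<le> ennreal (fact (k + 1) * pi)"
      using quadratic_kernel_deriv_norm_le by (intro Hardy_enorm_le_of_decay[OF assms]) auto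
  qed
  then show ?thesis
    using quadratic_kernel_holomorphic by (simp add: Hardy_Sobolev_def)
qed

text \<open>
  At most \<open>k \<le> n\<close> factors \<open>\<omega>\<close> arise from differentiation, and the normalisation by \<open>\<omega>\<^sup>n\<close> absorbs them;
  the constant collects the binomial coefficients and the factorials in the derivatives of the kernel.
\<close>
lemma modulated_quadratic_kernel_enorm_le:
  assumes p: "1 \<le> p" and \<omega>: "\<omega> \<ge> 1" and k: "k \<le> n"
  shows "Hardy_enorm p ((deriv ^^ k) (modulate n \<omega> quadratic_kernel)) \<le> ennreal (2 ^ n * fact (n + 1) * pi)"
proof (rule Hardy_enorm_le_of_decay[OF p])
  fix z assume z: "z \<in> UHP"
  have "norm ((deriv ^^ k) (modulate n \<omega> quadratic_kernel) z)
      = exp (- (\<omega> * Im z)) * norm (modulation_symbol n k \<omega> quadratic_kernel z)"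
    unfolding higher_deriv_modulate[OF quadratic_kernel_holomorphic z] norm_mult norm_exp_i_times ..
  also have "\<dots> \<le> 1 * norm (modulation_symbol n k \<omega> quadratic_kernel z)"
    using z \<omega> by (intro mult_right_mono) (auto simp: UHP_def)
  also have "norm (modulation_symbol n k \<omega> quadratic_kernel z)
      \<le> (\<Sum>i\<le>k. of_nat (k choose i) * (fact (n + 1) / (1 + (Re z)\<^sup>2)))"
    unfolding modulation_symbol_def
  proof (rule sum_norm_le)
    fix i assume i: "i \<in> {..k}"
    have "norm ((deriv ^^ (k - i)) quadratic_kernel z) \<le> fact (k - i + 1) / (1 + (Re z)\<^sup>2)"
      by (rule quadratic_kernel_deriv_norm_le[OF z])
    also have "\<dots> \<le> fact (n + 1) / (1 + (Re z)\<^sup>2)"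
      using k by (intro divide_right_mono fact_mono) auto
    finally show "norm (of_nat (k choose i) * (\<i> * of_real \<omega>) ^ i / of_real \<omega> ^ n
          * (deriv ^^ (k - i)) quadratic_kernel z)
        \<le> of_nat (k choose i) * (fact (n + 1) / (1 + (Re z)\<^sup>2))"
      unfolding norm_mult[of _ "(deriv ^^ (k - i)) quadratic_kernel z"]
      using i k \<omega> by (intro mult_mono modulation_coeff_norm(1)) auto
  qed
  also have "\<dots> = 2 ^ k * (fact (n + 1) / (1 + (Re z)\<^sup>2))"
    unfolding sum_distrib_right[symmetric] of_nat_sum[symmetric] choose_row_sum by simp
  also have "\<dots> \<le> 2 ^ n * (fact (n + 1) / (1 + (Re z)\<^sup>2))"
    using k by (intro mult_right_mono power_increasing) (auto simp: add_nonneg_nonneg)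
  finally show "norm ((deriv ^^ k) (modulate n \<omega> quadratic_kernel) z)
      \<le> 2 ^ n * fact (n + 1) / (1 + (Re z)\<^sup>2)"
    by simp
qed simp

lemma modulated_quadratic_kernel_Hardy_Sobolev:
  assumes "1 \<le> p" "\<omega> \<ge> 1"
  shows "modulate n \<omega> quadratic_kernel \<in> Hardy_Sobolev n p"
proof -
  have hol: "modulate n \<omega> quadratic_kernel holomorphic_on UHP"
    using assms by (intro modulate_holomorphic quadratic_kernel_holomorphic) auto
  then have "(deriv ^^ k) (modulate n \<omega> quadratic_kernel) \<in> Hardy p" if "k \<le> n" for k
    using modulated_quadratic_kernel_enorm_le[OF assms that] open_UHP
    by (intro HardyI holomorphic_higher_deriv)
  then show ?thesis
    using hol by (simp add: Hardy_Sobolev_def)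
qed

section \<open>The Hardy--Sobolev norm\<close>

lemma Hardy_Sobolev_norm_nonneg: "Hardy_Sobolev_norm n p F \<ge> 0"
  by (auto simp: Hardy_Sobolev_norm_def intro!: sum_nonneg Hardy_norm_nonneg)

lemma Hardy_Sobolev_norm_bound:
  assumes "1 \<le> p" "D \<ge> 0" and le: "\<And>k. k \<le> n \<Longrightarrow> Hardy_norm p ((deriv ^^ k) F) \<le> D"
  shows "Hardy_Sobolev_norm n p F \<le>
    (if p = \<infinity> then \<Sum>k\<le>n. D else (\<Sum>k\<le>n. D powr enn2real p) powr (1 / enn2real p))"
proof (cases "p = \<infinity>")
  case True
  then show ?thesis
    using le by (auto simp: Hardy_Sobolev_norm_def simp del: sum_constant intro!: sum_mono)
next
  case False
  have "(\<Sum>k\<le>n. Hardy_norm p ((deriv ^^ k) F) powr enn2real p) powr (1 / enn2real p)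
      \<le> (\<Sum>k\<le>n. D powr enn2real p) powr (1 / enn2real p)"
    by (intro powr_mono2 sum_mono sum_nonneg) (auto intro!: Hardy_norm_nonneg le)
  then show ?thesis
    using False by (simp add: Hardy_Sobolev_norm_def del: sum_constant)
qed

lemma Hardy_norm_le_Hardy_Sobolev_norm:
  assumes p: "1 \<le> p" and k: "k \<le> n"
  shows "Hardy_norm p ((deriv ^^ k) F) \<le> Hardy_Sobolev_norm n p F"
proof (cases "p = \<infinity>")
  case True
  have "Hardy_norm p ((deriv ^^ k) F) \<le> (\<Sum>k\<le>n. Hardy_norm p ((deriv ^^ k) F))"
    using k by (intro member_le_sum Hardy_norm_nonneg) auto
  then show ?thesis
    using True by (simp add: Hardy_Sobolev_norm_def)
next
  case False
  let ?q = "enn2real p"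
  have q: "?q \<ge> 1"
    using enn2real_exponent_ge_1[OF p False] .
  have "Hardy_norm p ((deriv ^^ k) F) = (Hardy_norm p ((deriv ^^ k) F) powr ?q) powr (1 / ?q)"
    using q by (simp add: powr_powr Hardy_norm_nonneg)
  also have "\<dots> \<le> (\<Sum>k\<le>n. Hardy_norm p ((deriv ^^ k) F) powr ?q) powr (1 / ?q)"
    using k q by (intro powr_mono2 member_le_sum) auto
  finally show ?thesis
    using False by (simp add: Hardy_Sobolev_norm_def)
qed

lemma higher_deriv_cong_UHP:
  assumes "\<And>w. w \<in> UHP \<Longrightarrow> f w = g w" "z \<in> UHP"
  shows "(deriv ^^ k) f z = (deriv ^^ k) g z"
proof (rule higher_deriv_cong_ev[OF _ refl])
  show "\<forall>\<^sub>F w in nhds z. f w = g w"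
    using eventually_nhds_in_open[OF open_UHP assms(2)] by eventually_elim (rule assms(1))
qed

lemma Hardy_Sobolev_norm_cong:
  assumes "\<And>w. w \<in> UHP \<Longrightarrow> f w = g w"
  shows "Hardy_Sobolev_norm n p f = Hardy_Sobolev_norm n p g"
proof -
  have "Hardy_norm p ((deriv ^^ k) f) = Hardy_norm p ((deriv ^^ k) g)" for k
    unfolding Hardy_norm_def by (rule arg_cong[OF Hardy_enorm_cong]) (rule higher_deriv_cong_UHP[OF assms])
  then show ?thesis
    by (simp only: Hardy_Sobolev_norm_def)
qed

lemma Hardy_enorm_zero:
  assumes "1 \<le> p"
  shows "Hardy_enorm p (\<lambda>_. 0) = 0"
  using Hardy_enorm_le_of_decay[OF assms, of 0 "\<lambda>_. 0"] by simp

lemma higher_deriv_zero: "(deriv ^^ k) (\<lambda>_. 0) = (\<lambda>_. 0 :: complex)"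
  by (induction k) simp_all

lemma zero_in_Hardy_Sobolev:
  assumes "1 \<le> p"
  shows "(\<lambda>_. 0) \<in> Hardy_Sobolev n p"
  by (simp add: Hardy_Sobolev_def Hardy_def higher_deriv_zero Hardy_enorm_zero[OF assms])

lemma Hardy_Sobolev_norm_zero:
  assumes "1 \<le> p"
  shows "Hardy_Sobolev_norm n p (\<lambda>_. 0) = 0"
  unfolding Hardy_Sobolev_norm_def higher_deriv_zero Hardy_norm_def Hardy_enorm_zero[OF assms] by simp

section \<open>Compact multiplication operators\<close>

text \<open>
  A function that vanishes on the half-plane need not vanish as a total function, so the image of the
  operator is only equivalent to \<open>0\<close>; it is still at distance \<open>0\<close> from the zero function, and every
  sequence of images converges to it.
\<close>
lemma mult_op_zero_compact:
  assumes p: "1 \<le> p" and \<psi>: "\<psi> \<in> multipliers n p" and zero: "\<forall>z\<in>UHP. \<psi> z = 0"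
  shows "compact_operator_on (Hardy_Sobolev n p) (Hardy_Sobolev_norm n p) (mult_op \<psi>)"
proof -
  have "Hardy_Sobolev_norm n p (\<lambda>z. mult_op \<psi> F z - 0) = 0" for F
    using Hardy_Sobolev_norm_cong[of "\<lambda>z. mult_op \<psi> F z - 0" "\<lambda>_. 0"] zero
      Hardy_Sobolev_norm_zero[OF p] by (simp add: mult_op_def)
  then have "\<exists>r G. strict_mono r \<and> G \<in> Hardy_Sobolev n p \<and>
      (\<lambda>j. Hardy_Sobolev_norm n p (\<lambda>z. mult_op \<psi> (F (r j)) z - G z)) \<longlonglongrightarrow> 0" for F :: "nat \<Rightarrow> _"
    using zero_in_Hardy_Sobolev[OF p]
    by (intro exI[of _ "\<lambda>j. j"] exI[of _ "\<lambda>_. 0"]) (auto simp: strict_mono_def)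
  then show ?thesis
    using \<psi> unfolding compact_operator_on_def
    by (auto simp: mult_op_def multipliers_def algebra_simps)
qed

text \<open>
  Above the real axis the modulated functions decay like \<open>e\<^bsup>-\<omega>y\<^esup>\<close>, hence so do their segment integrals,
  while those of the differences are controlled by the norm. A norm limit of modulated functions
  therefore has vanishing segment integrals.
\<close>
lemma zero_if_limit_of_modulations:
  assumes p: "1 \<le> p" and G: "G holomorphic_on UHP" and L: "L holomorphic_on UHP"
    and \<omega>: "\<And>j. \<omega> j \<ge> 1" "filterlim \<omega> at_top sequentially"
    and N: "\<And>j. N j \<ge> 0" "N \<longlonglongrightarrow> 0"
      "\<And>j. Hardy_enorm p (\<lambda>z. modulate n (\<omega> j) G z - L z) \<le> ennreal (N j)"
    and z: "z \<in> UHP"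
  shows "L z = 0"
proof (rule zero_if_horizontal_integrals_zero[OF L _ z])
  fix h :: real assume h: "0 \<le> h" "h \<le> 1"
  define K where "K = integral {0..h} (\<lambda>t. norm (G (z + of_real t)))"
  have y: "Im z > 0"
    using z by (simp add: UHP_def)
  have contG: "continuous_on UHP G" and contL: "continuous_on UHP L"
    using G L by (simp_all add: holomorphic_on_imp_continuous_on)
  have contM: "continuous_on UHP (modulate n (\<omega> j) G)" for j
    using modulate_holomorphic[OF G, of "\<omega> j"] \<omega>(1)[of j] by (simp add: holomorphic_on_imp_continuous_on)
  have M_le: "norm (modulate n (\<omega> j) G (z + of_real t)) \<le> exp (- (\<omega> j * Im z)) * norm (G (z + of_real t))" for j t
  proof -
    have "norm (G (z + of_real t)) / \<omega> j ^ n \<le> norm (G (z + of_real t)) / 1"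
      using \<omega>(1)[of j] by (intro divide_left_mono) (auto intro: one_le_power)
    then have "norm (G (z + of_real t) / of_real (\<omega> j) ^ n) \<le> norm (G (z + of_real t))"
      using \<omega>(1)[of j] by (simp add: norm_divide norm_power)
    moreover have "norm (exp (\<i> * of_real (\<omega> j) * (z + of_real t))) = exp (- (\<omega> j * Im z))"
      by simp
    ultimately show ?thesis
      unfolding modulate_def norm_mult by (intro mult_mono) auto
  qed
  have le: "norm (horizontal_integral h L z) \<le> exp (- (\<omega> j * Im z)) * K + 2 * N j" for j
  proof -
    let ?M = "modulate n (\<omega> j) G"
    have "horizontal_integral h L z = horizontal_integral h ?M z - horizontal_integral h (\<lambda>z. ?M z - L z) z"
      using segment_integrable[OF contM z] segment_integrable[OF contL z]
      by (simp add: horizontal_integral_def integral_diff)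
    then have "norm (horizontal_integral h L z) \<le> norm (horizontal_integral h ?M z) + norm (horizontal_integral h (\<lambda>z. ?M z - L z) z)"
      by (simp add: norm_triangle_ineq4)
    also have "norm (horizontal_integral h ?M z) \<le> integral {0..h} (\<lambda>t. norm (?M (z + of_real t)))"
      by (rule norm_horizontal_integral_le[OF contM z])
    also have "\<dots> \<le> integral {0..h} (\<lambda>t. exp (- (\<omega> j * Im z)) * norm (G (z + of_real t)))"
    proof (rule integral_le[OF _ _ M_le])
      show "(\<lambda>t. norm (?M (z + of_real t))) integrable_on {0..h}"
        by (rule segment_integrable[OF continuous_on_norm[OF contM] z])
      show "(\<lambda>t. exp (- (\<omega> j * Im z)) * norm (G (z + of_real t))) integrable_on {0..h}"
        by (rule integrable_on_mult_right[OF segment_integrable[OF continuous_on_norm[OF contG] z]])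
    qed
    also have "\<dots> = exp (- (\<omega> j * Im z)) * K"
      by (simp add: K_def)
    also have "norm (horizontal_integral h (\<lambda>z. ?M z - L z) z)
        \<le> integral {0..h} (\<lambda>t. norm (?M (z + of_real t) - L (z + of_real t)))"
      by (rule norm_horizontal_integral_le[OF continuous_on_diff[OF contM contL] z])
    also have "\<dots> \<le> 2 * N j"
      by (rule integral_segment_le_Hardy_norm[OF p continuous_on_diff[OF contM contL] N(1) N(3) z h])
    finally show ?thesis by simp
  qed
  have "filterlim (\<lambda>j. Im z * \<omega> j) at_top sequentially"
    using filterlim_tendsto_pos_mult_at_top[OF tendsto_const y \<omega>(2)] .
  then have "(\<lambda>j. exp (- (\<omega> j * Im z))) \<longlonglongrightarrow> 0"
    by (intro filterlim_compose[OF exp_at_bot]) (simp add: filterlim_uminus_at_bot mult.commute)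
  then have "(\<lambda>j. exp (- (\<omega> j * Im z)) * K + 2 * N j) \<longlonglongrightarrow> 0 * K + 2 * 0"
    using N(2) by (intro tendsto_intros)
  then have "norm (horizontal_integral h L z) \<le> 0 * K + 2 * 0"
    by (rule tendsto_lowerbound) (simp_all add: le)
  then show "horizontal_integral h L z = 0" by simp
qed

text \<open>
  The operator sends the modulated kernel to the modulation of \<open>G = \<psi> \<cdot> kernel\<close>. Along a convergent
  subsequence the limit is \<open>0\<close>, so the norms of these modulations tend to \<open>0\<close>; but they bound the size
  of \<open>G\<close> near the boundary. Hence \<open>G = 0\<close>, and the kernel has no zeros.
\<close>
lemma zero_if_mult_op_compact:
  assumes p: "1 \<le> p" and \<psi>: "\<psi> \<in> multipliers n p"
    and compact: "compact_operator_on (Hardy_Sobolev n p) (Hardy_Sobolev_norm n p) (mult_op \<psi>)"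
    and w: "w \<in> UHP"
  shows "\<psi> w = 0"
proof -
  define G where "G = (\<lambda>z. \<psi> z * quadratic_kernel z)"
  define F where "F = (\<lambda>j::nat. modulate n (real j + 1) quadratic_kernel)"
  define D :: real where "D = 2 ^ n * fact (n + 1) * pi"
  have G: "G \<in> Hardy_Sobolev n p"
    using \<psi> quadratic_kernel_Hardy_Sobolev[OF p] by (simp add: multipliers_def G_def)
  have holG: "G holomorphic_on UHP"
    using G by (simp add: Hardy_Sobolev_def)
  have F: "F j \<in> Hardy_Sobolev n p" for j
    unfolding F_def by (rule modulated_quadratic_kernel_Hardy_Sobolev[OF p]) simp
  have TF: "mult_op \<psi> (F j) = modulate n (real j + 1) G" for j
    by (simp add: fun_eq_iff mult_op_def F_def modulate_def G_def)
  have "Hardy_norm p ((deriv ^^ k) (F j)) \<le> D" if "k \<le> n" for k j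
    unfolding F_def D_def by (rule Hardy_norm_le[OF modulated_quadratic_kernel_enorm_le[OF p _ that]]) simp_all
  moreover have "D \<ge> 0"
    by (simp add: D_def)
  ultimately obtain B where "Hardy_Sobolev_norm n p (F j) \<le> B" for j
    using Hardy_Sobolev_norm_bound[OF p] by blast
  then have "bounded (range (\<lambda>j. Hardy_Sobolev_norm n p (F j)))"
    by (intro boundedI[of _ B]) (auto simp: Hardy_Sobolev_norm_nonneg)
  then obtain r L where r: "strict_mono r" and L: "L \<in> Hardy_Sobolev n p"
    and lim: "(\<lambda>j. Hardy_Sobolev_norm n p (\<lambda>z. mult_op \<psi> (F (r j)) z - L z)) \<longlonglongrightarrow> 0"
    using compact F unfolding compact_operator_on_def by blast
  define \<omega> where "\<omega> = (\<lambda>j. real (r j) + 1)"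
  define H where "H = (\<lambda>j z. modulate n (\<omega> j) G z - L z)"
  define N where "N = (\<lambda>j. Hardy_Sobolev_norm n p (H j))"
  have N: "N \<longlonglongrightarrow> 0" "N j \<ge> 0" for j
    using lim by (simp_all add: N_def H_def TF \<omega>_def Hardy_Sobolev_norm_nonneg)
  have \<omega>1: "\<omega> j \<ge> 1" for j
    by (simp add: \<omega>_def)
  have \<omega>: "filterlim \<omega> at_top sequentially"
    by (rule filterlim_at_top_mono[OF filterlim_real_sequentially])
       (auto simp: \<omega>_def intro!: always_eventually add_increasing2 seq_suble[OF r])
  have M_Hardy: "(deriv ^^ k) (modulate n (\<omega> j) G) \<in> Hardy p" if "k \<le> n" for k j
  proof -
    have "mult_op \<psi> (F (r j)) \<in> Hardy_Sobolev n p"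
      using compact F by (simp add: compact_operator_on_def)
    then show ?thesis
      using that by (simp add: TF \<omega>_def Hardy_Sobolev_def)
  qed
  have holL: "L holomorphic_on UHP" and L_Hardy: "L \<in> Hardy p"
    using L by (auto simp: Hardy_Sobolev_def dest: spec[of _ 0])
  have N_deriv: "Hardy_norm p ((deriv ^^ k) (H j)) \<le> N j" if "k \<le> n" for k j
    unfolding N_def by (rule Hardy_norm_le_Hardy_Sobolev_norm[OF p that])
  have L0: "L z = 0" if "z \<in> UHP" for z
  proof (rule zero_if_limit_of_modulations[OF p holG holL \<omega>1 \<omega> N(2) N(1) _ that])
    fix j
    have "H j \<in> Hardy p"
      unfolding H_def using M_Hardy[of 0 j] L_Hardy by (intro Hardy_diff[OF p]) simp_all
    then show "Hardy_enorm p (\<lambda>z. modulate n (\<omega> j) G z - L z) \<le> ennreal (N j)"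
      using N_deriv[of 0 j] Hardy_enorm_eq_norm[of "H j" p]
      by (simp add: H_def ennreal_leI)
  qed
  have top: "Hardy_enorm p ((deriv ^^ n) (modulate n (\<omega> j) G)) \<le> ennreal (N j)" for j
  proof -
    \<comment> \<open>The limit vanishes on the half-plane, so it may be dropped from the \<open>n\<close>-th derivative.\<close>
    have eq: "Hardy_enorm p ((deriv ^^ n) (modulate n (\<omega> j) G)) = Hardy_enorm p ((deriv ^^ n) (H j))"
      by (intro Hardy_enorm_cong higher_deriv_cong_UHP) (simp_all add: H_def L0)
    have "Hardy_enorm p ((deriv ^^ n) (modulate n (\<omega> j) G)) = ennreal (Hardy_norm p ((deriv ^^ n) (H j)))"
      using Hardy_enorm_eq_norm[OF M_Hardy[of n j]] eq by (simp add: Hardy_norm_def)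
    then show ?thesis
      using N_deriv[of n j] by (simp add: ennreal_leI)
  qed
  define K where "K = (\<Sum>i<n. of_nat (n choose i) * (2 * Hardy_norm p ((deriv ^^ (n - i)) G)))"
  have inv: "(\<lambda>j. 1 / \<omega> j) \<longlonglongrightarrow> 0"
    using tendsto_inverse_0_at_top[OF \<omega>] by (simp add: inverse_eq_divide)
  have "G w = 0"
  proof (rule zero_if_horizontal_integrals_vanish_at_boundary[OF p _ _ inv _ _ w])
    show "G \<in> Hardy p"
      using G by (auto simp: Hardy_Sobolev_def dest: spec[of _ 0])
    show "1 / \<omega> j > 0" for j
      using \<omega>1[of j] by simp
    have "(\<lambda>j. 2 * exp 1 * N j + K * (1 / \<omega> j)) \<longlonglongrightarrow> 2 * exp 1 * 0 + K * 0"
      by (intro tendsto_intros N inv)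
    then show "(\<lambda>j. 2 * exp 1 * N j + K / \<omega> j) \<longlonglongrightarrow> 0"
      by simp
    show "norm (horizontal_integral h G z) \<le> 2 * exp 1 * N j + K / \<omega> j"
      if "0 \<le> h" "h \<le> 1" "Im z = 1 / \<omega> j" for h j z
      unfolding K_def by (rule horizontal_integral_le_modulation[OF p G \<omega>1 N(2) top that])
  qed
  then show ?thesis
    using UHP_shift_i_nonzero[OF w] by (simp add: G_def quadratic_kernel_def)
qed

theorem corollary5p6:
  fixes p :: ennreal and n :: nat and \<psi> :: "complex \<Rightarrow> complex"
  assumes "1 \<le> p"
    and "\<psi> \<in> multipliers n p"
  shows "compact_operator_on (Hardy_Sobolev n p) (Hardy_Sobolev_norm n p) (mult_op \<psi>)
           \<longleftrightarrow> (\<forall>z\<in>UHP. \<psi> z = 0)"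
  using zero_if_mult_op_compact[OF assms] mult_op_zero_compact[OF assms] by blast

end
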